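(* Let $q,m$ be positive integers with $q\ge 3$, let $t=\lceil\sqrt{q-1}\,\rceil$, let $n=(2q+2t-1)m$ and let $d$ be an integer with $d\ge\max\{q+t,\ q+\lceil (q-1)/t\rceil+1\}$. Then any equivalent-structure learning algorithm for proper vertex $q$-colorings and the graph family $\mathcal{F}_{m,t}$ that succeeds with probability at least $q\cdot\exp[-m/(2(q-1))]$ requires at least $\exp[m/(2(q-1))]$ samples.
   Context: For a graph $G$, $\Omega_G$ is the set of proper $q$-colorings of $G$ and $\pi_G$ the uniform distribution on $\Omega_G$. The graph $G_{m,t}=(V_{m,t},E_{m,t})$ (for positive integers $m$ and $t<q$) consists of cliques $C_1,\dots,C_m,C_1',\dots,C_m'$ each of size $q-1$, independent sets $I_1,\dots,I_m,I_1',\dots,I_m'$ each of size $t$ (with a fixed ordering of the vertices of each), and further vertices $s_1,\dots,s_m$, all disjoint. Its edges are: the edges inside each clique $C_i$, $C_i'$; for $1\le i\le m$ all edges between $C_i$ and $I_i$; for $2\le i\le m$, $C_i$ is partitioned into $t$ disjoint subsets $C_{i,1},\dots,C_{i,t}$ each of size $\lfloor (q-1)/t\rfloor$ or $\lceil (q-1)/t\rceil$, and the $j$-th vertex of $I_{i-1}$ is joined to every vertex of $C_{i,j}$; the same edges between the $C_i'$ and $I_i'$ defined identically; and for each $1\le i\le m$, $s_i$ is adjacent to exactly one vertex of $I_i$ and exactly one vertex of $I_i'$. No other edges. For each $i$ fix $x_i\in C_i$ and $y_i\in I_i'$ not adjacent to $s_i$; let $M=\{\{x_i,y_i\}:1\le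 i\le m\}$ and $\mathcal{G}_{m,t}=\{(V_{m,t},E_{m,t}\cup S):S\subseteq M\}$. Let $\mathcal{G}(n,d)$ be the family of graphs on vertex set $V_{m,t}$ (which has $n$ vertices) of maximum degree at most $d$, and $\mathcal{F}_{m,t}=\{G\in\mathcal{G}(n,d):\Omega_G=\Omega_{G'}\text{ for some }G'\in\mathcal{G}_{m,t}\}$. An equivalent-structure learning algorithm for a family $\mathcal{F}$ receives $L$ independent samples from $\pi_G$ for an unknown $G\in\mathcal{F}$ and outputs $G'\in\mathcal{F}$; it succeeds with probability at least $p$ if $\Pr[\Omega_{G'}=\Omega_G]\ge p$ for every $G\in\mathcal{F}$. *)

theory Defs
  imports "HOL-Probability.Probability"
begin

section \<open>Graphs and colorings\<close>

type_synonym 'v graph = "'v set \<times> 'v set set"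

abbreviation verts :: "'v graph \<Rightarrow> 'v set" where "verts \<equiv> fst"
abbreviation edges :: "'v graph \<Rightarrow> 'v set set" where "edges \<equiv> snd"

definition simple_graph :: "'v graph \<Rightarrow> bool" where
  "simple_graph G \<longleftrightarrow> (\<forall>e \<in> edges G. e \<subseteq> verts G \<and> card e = 2)"

definition degree :: "'v graph \<Rightarrow> 'v \<Rightarrow> nat" where
  "degree G v = card {e \<in> edges G. v \<in> e}"

text \<open>
  Simple graphs of maximum degree at most \<open>d\<close> on the vertex set \<open>V\<close>, which is required to have
  exactly \<open>n\<close> elements.
\<close>
definition bounded_degree_graphs :: "'v set \<Rightarrow> nat \<Rightarrow> nat \<Rightarrow> 'v graph set" where
  "bounded_degree_graphs V n d =
     {G. verts G = V \<and> card V = n \<and> simple_graph G \<and> (\<forall>v \<in> V. degree G v \<le> d)}"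

text \<open>
  Colorings are extensional functions, so that two of them are equal iff they agree on the vertices
  and the set of all proper colorings of a finite graph is finite.
\<close>
definition proper_colorings :: "nat \<Rightarrow> 'v graph \<Rightarrow> ('v \<Rightarrow> nat) set" where
  "proper_colorings q G =
     {f \<in> verts G \<rightarrow>\<^sub>E {1..q}. \<forall>u v. {u, v} \<in> edges G \<longrightarrow> f u \<noteq> f v}"

definition uniform_coloring :: "nat \<Rightarrow> 'v graph \<Rightarrow> ('v \<Rightarrow> nat) pmf" where
  "uniform_coloring q G = pmf_of_set (proper_colorings q G)"


section \<open>The graphs built from chains of cliques and independent sets\<close>

text \<open>
  The two copies of the construction are told apart by a \<open>side\<close>: \<open>Primed\<close> stands for the
  \<open>C'\<close> and \<open>I'\<close> parts. The last argument of \<open>Clique\<close> and \<open>Indep\<close> numbers the vertices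
  within the set; for the independent sets this is their fixed ordering.
\<close>
datatype side = Unprimed | Primed

datatype vertex = Clique side nat nat | Indep side nat nat | Link nat

definition clique_set :: "nat \<Rightarrow> side \<Rightarrow> nat \<Rightarrow> vertex set" where
  "clique_set q b i = Clique b i ` {1..q - 1}"

definition indep_set :: "nat \<Rightarrow> side \<Rightarrow> nat \<Rightarrow> vertex set" where
  "indep_set t b i = Indep b i ` {1..t}"

definition chain_verts :: "nat \<Rightarrow> nat \<Rightarrow> nat \<Rightarrow> vertex set" where
  "chain_verts q m t =
     (\<Union>b. \<Union>i \<in> {1..m}. clique_set q b i \<union> indep_set t b i) \<union> Link ` {1..m}"

text \<open>
  \<open>P b i j\<close> is the part of the \<open>i\<close>-th clique on side \<open>b\<close> that is joined to the \<open>j\<close>-th vertex of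
  the preceding independent set; it only matters for \<open>2 \<le> i\<close>.
\<close>
definition balanced_partitions ::
    "nat \<Rightarrow> nat \<Rightarrow> nat \<Rightarrow> (side \<Rightarrow> nat \<Rightarrow> nat \<Rightarrow> vertex set) \<Rightarrow> bool" where
  "balanced_partitions q m t P \<longleftrightarrow>
     (\<forall>b. \<forall>i \<in> {2..m}.
        (\<Union>j \<in> {1..t}. P b i j) = clique_set q b i \<and>
        disjoint_family_on (P b i) {1..t} \<and>
        (\<forall>j \<in> {1..t}. int (card (P b i j)) \<in>
           {\<lfloor>real (q - 1) / real t\<rfloor>, \<lceil>real (q - 1) / real t\<rceil>}))"

text \<open>
  \<open>a b i\<close> is the unique neighbor of \<open>Link i\<close> in the \<open>i\<close>-th independent set on side \<open>b\<close>.
\<close>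
definition chain_edges ::
    "nat \<Rightarrow> nat \<Rightarrow> nat \<Rightarrow> (side \<Rightarrow> nat \<Rightarrow> nat \<Rightarrow> vertex set) \<Rightarrow> (side \<Rightarrow> nat \<Rightarrow> vertex)
      \<Rightarrow> vertex set set" where
  "chain_edges q m t P a =
     {{u, v} | b i u v. i \<in> {1..m} \<and> u \<in> clique_set q b i \<and> v \<in> clique_set q b i \<and> u \<noteq> v} \<union>
     {{u, v} | b i u v. i \<in> {1..m} \<and> u \<in> clique_set q b i \<and> v \<in> indep_set t b i} \<union>
     {{Indep b (i - 1) j, v} | b i j v. i \<in> {2..m} \<and> j \<in> {1..t} \<and> v \<in> P b i j} \<union>
     {{Link i, a b i} | b i. i \<in> {1..m}}"

definition augmented_chain_graphs ::
    "nat \<Rightarrow> nat \<Rightarrow> nat \<Rightarrow> (side \<Rightarrow> nat \<Rightarrow> nat \<Rightarrow> vertex set) \<Rightarrow> (side \<Rightarrow> nat \<Rightarrow> vertex)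
      \<Rightarrow> (nat \<Rightarrow> vertex) \<Rightarrow> (nat \<Rightarrow> vertex) \<Rightarrow> vertex graph set" where
  "augmented_chain_graphs q m t P a x y =
     {(chain_verts q m t, chain_edges q m t P a \<union> S) | S. S \<subseteq> {{x i, y i} | i. i \<in> {1..m}}}"

definition chain_family ::
    "nat \<Rightarrow> nat \<Rightarrow> nat \<Rightarrow> nat \<Rightarrow> nat \<Rightarrow> (side \<Rightarrow> nat \<Rightarrow> nat \<Rightarrow> vertex set) \<Rightarrow> (side \<Rightarrow> nat \<Rightarrow> vertex)
      \<Rightarrow> (nat \<Rightarrow> vertex) \<Rightarrow> (nat \<Rightarrow> vertex) \<Rightarrow> vertex graph set" where
  "chain_family q m t n d P a x y =
     {G \<in> bounded_degree_graphs (chain_verts q m t) n d.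
        \<exists>G' \<in> augmented_chain_graphs q m t P a x y. proper_colorings q G = proper_colorings q G'}"

lemma card_chain_verts:
  assumes "q \<ge> 1"
  shows "card (chain_verts q m t) = (2 * q + 2 * t - 1) * m"
proof -
  define C where "C = (\<lambda>(b, i, k). Clique b i k) ` ({Unprimed, Primed} \<times> {1..m} \<times> {1..q - 1})"
  define I where "I = (\<lambda>(b, i, k). Indep b i k) ` ({Unprimed, Primed} \<times> {1..m} \<times> {1..t})"
  define S where "S = Link ` {1..m}"
  have "chain_verts q m t = (C \<union> I) \<union> S"
  proof (rule set_eqI)
    fix v show "v \<in> chain_verts q m t \<longleftrightarrow> v \<in> (C \<union> I) \<union> S"
    proof (cases v)
      case (Clique b i k)
      then show ?thesis
        by (cases b) (simp_all add: chain_verts_def clique_set_def indep_set_def C_def I_def S_def image_iff)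
    next
      case (Indep b i k)
      then show ?thesis
        by (cases b) (simp_all add: chain_verts_def clique_set_def indep_set_def C_def I_def S_def image_iff)
    next
      case (Link i)
      then show ?thesis
        by (auto simp: chain_verts_def clique_set_def indep_set_def C_def I_def S_def)
    qed
  qed
  moreover have "finite C" "finite I" "finite S"
    unfolding C_def I_def S_def by simp_all
  moreover have "C \<inter> I = {}" "(C \<union> I) \<inter> S = {}"
    unfolding C_def I_def S_def by auto
  ultimately have "card (chain_verts q m t) = card C + card I + card S"
    by (simp add: card_Un_disjoint)
  moreover have "card C = 2 * (m * (q - 1))"
    unfolding C_def by (subst card_image) (auto simp: inj_on_def card_cartesian_product)
  moreover have "card I = 2 * (m * t)"
    unfolding I_def by (subst card_image) (auto simp: inj_on_def card_cartesian_product)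
  moreover have "card S = m"
    unfolding S_def by (subst card_image) (auto simp: inj_on_def)
  ultimately have "card (chain_verts q m t) = (2 * (q - 1) + 2 * t + 1) * m"
    by (simp add: algebra_simps)
  also have "2 * (q - 1) + 2 * t + 1 = 2 * q + 2 * t - 1"
    using assms by simp
  finally show ?thesis .
qed


section \<open>Equivalent-structure learning\<close>

text \<open>
  An algorithm may use internal randomness: it maps a list of \<open>L\<close> sampled colorings to a
  distribution over output graphs. A deterministic algorithm is the case of point masses.
\<close>
type_synonym 'v learner = "('v \<Rightarrow> nat) list \<Rightarrow> 'v graph pmf"

definition learning_algorithm :: "nat \<Rightarrow> 'v graph set \<Rightarrow> nat \<Rightarrow> 'v learner \<Rightarrow> bool" where
  "learning_algorithm q F L A \<longleftrightarrow>
     (\<forall>G \<in> F. \<forall>xs. length xs = L \<and> set xs \<subseteq> proper_colorings q G \<longrightarrow> set_pmf (A xs) \<subseteq> F)"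

definition learner_output :: "nat \<Rightarrow> nat \<Rightarrow> 'v learner \<Rightarrow> 'v graph \<Rightarrow> 'v graph pmf" where
  "learner_output q L A G = bind_pmf (replicate_pmf L (uniform_coloring q G)) A"

definition succeeds_with_prob :: "nat \<Rightarrow> 'v graph set \<Rightarrow> nat \<Rightarrow> 'v learner \<Rightarrow> real \<Rightarrow> bool" where
  "succeeds_with_prob q F L A p \<longleftrightarrow>
     (\<forall>G \<in> F. measure_pmf.prob (learner_output q L A G)
                {G'. proper_colorings q G' = proper_colorings q G} \<ge> p)"

end

theory Submission
  imports Defs
begin

text \<open>
  In a proper coloring the clique \<open>C\<^sub>i\<close> uses \<open>q - 1\<close> colors, so \<open>I\<^sub>i\<close> receives the one remaining color,
  and the edges from \<open>I\<^sub>i\<close> to \<open>C\<^sub>i\<^sub>+\<^sub>1\<close> propagate this color along the chain. A coloring thus has one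
  color \<open>\<kappa> b\<close> per side \<open>b\<close>. If both are equal, all matching edges \<open>{x i, y i}\<close> are automatically
  respected, so such a coloring carries no information on which of the \<open>2\<^sup>m\<close> graphs is sampled. The
  link vertices have \<open>q - 1\<close> available colors in that case and only \<open>q - 2\<close> otherwise, whence
  a sample is informative with probability at most \<open>(q - 1) exp (- m / (q - 1))\<close>. A union bound over
  the samples, together with a guessing probability of \<open>2\<^sup>-\<^sup>m\<close> on uninformative samples, bounds
  the success probability averaged over all \<open>2\<^sup>m\<close> graphs.
\<close>

section \<open>Indistinguishable samples\<close>

lemma pair_pmf_of_set:
  assumes "finite A" "A \<noteq> {}" "finite B" "B \<noteq> {}"
  shows "pair_pmf (pmf_of_set A) (pmf_of_set B) = pmf_of_set (A \<times> B)"
proof (rule pmf_eqI)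
  fix z :: "'a \<times> 'b"
  show "pmf (pair_pmf (pmf_of_set A) (pmf_of_set B)) z = pmf (pmf_of_set (A \<times> B)) z"
    using assms by (cases z) (simp add: pmf_pair card_cartesian_product indicator_def)
qed

text \<open>Turns the expectation over \<open>L\<close> independent samples into a finite average
  over lists, in which lists inside \<open>Z\<close> can be separated from the rest by
  counting.\<close>

lemma replicate_pmf_of_set:
  assumes "finite S" "S \<noteq> {}"
  shows "replicate_pmf n (pmf_of_set S) = pmf_of_set {xs \<in> lists S. length xs = n}"
proof (induction n)
  case 0
  have "{xs \<in> lists S. length xs = 0} = {[]}" by auto
  then show ?case by (simp add: pmf_of_set_singleton)
next
  case (Suc n)
  define T where "T = {xs \<in> lists S. length xs = n}"
  have T: "T = {xs. set xs \<subseteq> S \<and> length xs = n}" by (auto simp: T_def lists_eq_set)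
  have "finite T" using assms by (simp add: T finite_lists_length_eq)
  moreover obtain s where "s \<in> S" using assms by auto
  then have "replicate n s \<in> T" by (auto simp: T)
  then have "T \<noteq> {}" by auto
  moreover have "replicate_pmf (Suc n) (pmf_of_set S) =
      map_pmf (\<lambda>(x, xs). x # xs) (pair_pmf (pmf_of_set S) (pmf_of_set T))"
    by (simp add: Suc T_def pair_pmf_def map_bind_pmf bind_assoc_pmf bind_return_pmf map_pmf_def)
  moreover have "inj_on (\<lambda>(x, xs). x # xs) (S \<times> T)" by (auto simp: inj_on_def)
  moreover have "(\<lambda>(x, xs). x # xs) ` (S \<times> T) = {xs \<in> lists S. length xs = Suc n}"
    by (auto simp: T length_Suc_conv lists_eq_set image_iff)
  ultimately show ?case
    using assms by (simp add: pair_pmf_of_set map_pmf_of_set_inj)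
qed

lemma prob_bind_pmf:
  "measure_pmf.prob (bind_pmf p f) X = measure_pmf.expectation p (\<lambda>x. measure_pmf.prob (f x) X)"
proof -
  have "ennreal (measure_pmf.prob (bind_pmf p f) X) = (\<integral>\<^sup>+x. ennreal (measure_pmf.prob (f x) X) \<partial>p)"
    by (simp add: measure_pmf.emeasure_eq_measure[symmetric])
  also have "\<dots> = ennreal (measure_pmf.expectation p (\<lambda>x. measure_pmf.prob (f x) X))"
    by (intro nn_integral_eq_integral measure_pmf.integrable_const_bound[of _ 1]) auto
  finally show ?thesis by (simp add: integral_nonneg_AE)
qed

text \<open>A list of samples taken entirely from \<open>Z\<close> can occur under every
  \<open>J\<close>. On such a list the success events for different \<open>J\<close> are disjoint,
  because the coloring sets differ, so together they contribute at most 1 to the sum. Every other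
  list is conceded to the learner; for each \<open>J\<close> these lists have total probability at
  most \<open>real L * \<delta>\<close>.\<close>

lemma sum_success_prob_le:
  fixes \<Omega> :: "'i \<Rightarrow> ('v \<Rightarrow> nat) set" and A :: "'v learner" and G :: "'i \<Rightarrow> 'v graph"
  assumes I: "finite I" and inj: "inj_on (\<lambda>J. proper_colorings q (G J)) I"
    and fin: "\<And>J. J \<in> I \<Longrightarrow> finite (proper_colorings q (G J))"
    and sub: "\<And>J. J \<in> I \<Longrightarrow> Z \<subseteq> proper_colorings q (G J)"
    and Z: "finite Z" "Z \<noteq> {}"
    and card: "\<And>J. J \<in> I \<Longrightarrow> real (card (proper_colorings q (G J) - Z)) \<le> \<delta> * real (card Z)"
  shows "(\<Sum>J\<in>I. measure_pmf.prob (learner_output q L A (G J))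
             {H. proper_colorings q H = proper_colorings q (G J)}) \<le> real (card I) * (real L * \<delta>) + 1"
proof -
  define g where "g J xs = measure_pmf.prob (A xs)
    {H. proper_colorings q H = proper_colorings q (G J)}" for J xs
  define samples where "samples S = {xs \<in> lists S. length xs = L}" for S :: "('v \<Rightarrow> nat) set"
  have samples_conv: "samples S = {xs. set xs \<subseteq> S \<and> length xs = L}" for S
    by (auto simp: samples_def lists_eq_set)
  have finite_samples: "finite (samples S)" and card_samples: "card (samples S) = card S ^ L"
    if "finite S" for S
    using that by (simp_all add: samples_conv card_lists_length_eq finite_lists_length_eq)
  have g_nonneg: "g J xs \<ge> 0" and g_le_1: "g J xs \<le> 1" for J xs
    by (simp_all add: g_def)
  have cardZ: "card Z > 0" using Z by (simp add: card_gt_0_iff)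
  have bound: "measure_pmf.prob (learner_output q L A (G J))
      {H. proper_colorings q H = proper_colorings q (G J)}
      \<le> (\<Sum>xs\<in>samples Z. g J xs) / real (card Z) ^ L + real L * \<delta>" if J: "J \<in> I" for J
  proof -
    define S where "S = proper_colorings q (G J)"
    have S: "finite S" "Z \<subseteq> S" "S \<noteq> {}" using fin[OF J] sub[OF J] Z by (auto simp: S_def)
    define N where "N = real (card S) ^ L"
    have cardS: "card Z \<le> card S" using S by (simp add: card_mono)
    have N: "N > 0" "real (card Z) ^ L \<le> N" using cardZ cardS by (auto simp: N_def power_mono)
    have ne: "samples S \<noteq> {}"
      using card_samples[OF S(1)] cardS cardZ by force
    have "measure_pmf.prob (learner_output q L A (G J)) {H. proper_colorings q H = proper_colorings q (G J)}
        = measure_pmf.expectation (pmf_of_set (samples S)) (g J)"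
      using S ne unfolding learner_output_def uniform_coloring_def S_def[symmetric]
      by (simp add: prob_bind_pmf replicate_pmf_of_set g_def[abs_def] samples_def S_def)
    also have "\<dots> = (\<Sum>xs\<in>samples S. g J xs) / N"
      using S ne by (simp add: integral_pmf_of_set finite_samples card_samples N_def)
    also have "(\<Sum>xs\<in>samples S. g J xs) = (\<Sum>xs\<in>samples Z. g J xs) + (\<Sum>xs\<in>samples S - samples Z. g J xs)"
      using S by (subst sum.subset_diff[of "samples Z"]) (auto simp: samples_conv finite_lists_length_eq)
    also have "\<dots> / N = (\<Sum>xs\<in>samples Z. g J xs) / N + (\<Sum>xs\<in>samples S - samples Z. g J xs) / N"
      by (rule add_divide_distrib)
    \<comment> \<open>Replacing \<open>N\<close>, which depends on \<open>J\<close>, by the common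
      value \<open>real (card Z) ^ L\<close> makes it possible to exchange the sum over
      \<open>J\<close> with the sum over samples later.\<close>
    also have "(\<Sum>xs\<in>samples Z. g J xs) / N \<le> (\<Sum>xs\<in>samples Z. g J xs) / real (card Z) ^ L"
      using N cardZ by (intro divide_left_mono sum_nonneg g_nonneg) auto
    also have "(\<Sum>xs\<in>samples S - samples Z. g J xs) / N \<le> real L * \<delta>"
    proof -
      \<comment> \<open>\<open>r\<close> is the probability that one sample lies in
        \<open>Z\<close>, so \<open>1 - r ^ L\<close> is the probability that some sample falls
        outside. Bernoulli's inequality plays the role of the union bound.\<close>
      define r where "r = real (card Z) / real (card S)"
      have "(\<Sum>xs\<in>samples S - samples Z. g J xs) \<le> real (card (samples S - samples Z))"
        using sum_bounded_above[of "samples S - samples Z" "g J" 1] g_le_1 by simp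
      also have "\<dots> = N - real (card Z) ^ L"
      proof -
        have "samples Z \<subseteq> samples S" using S by (auto simp: samples_conv)
        with S Z show ?thesis
          by (simp add: card_Diff_subset finite_samples card_samples N_def of_nat_diff power_mono cardS)
      qed
      finally have "(\<Sum>xs\<in>samples S - samples Z. g J xs) / N \<le> (N - real (card Z) ^ L) / N"
        using N by (intro divide_right_mono) auto
      also have "\<dots> = 1 - r ^ L"
        using N by (simp add: diff_divide_distrib r_def N_def power_divide)
      also have "\<dots> \<le> real L * (1 - r)"
        using Bernoulli_inequality[of "r - 1" L] by (simp add: r_def algebra_simps)
      also have "1 - r = real (card (S - Z)) / real (card S)"
        using S Z cardS cardZ by (simp add: card_Diff_subset of_nat_diff r_def field_simps)
      also have "\<dots> \<le> real (card (S - Z)) / real (card Z)"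
        using cardS cardZ by (intro divide_left_mono) auto
      also have "\<dots> \<le> \<delta>"
        using card[OF J] cardZ by (simp add: S_def field_simps)
      finally show ?thesis by (simp add: mult_left_mono)
    qed
    finally show ?thesis by simp
  qed
  \<comment> \<open>Injectivity enters here: one output graph has one set of proper colorings and so
    is correct for at most one \<open>J\<close>.\<close>
  have "(\<Sum>J\<in>I. g J xs) \<le> 1" for xs
  proof -
    have "(\<Sum>J\<in>I. g J xs) = measure_pmf.prob (A xs)
        (\<Union>J\<in>I. {H. proper_colorings q H = proper_colorings q (G J)})"
      unfolding g_def using inj
      by (intro measure_pmf.finite_measure_finite_Union[symmetric] I)
         (auto simp: disjoint_family_on_def inj_on_def)
    also have "\<dots> \<le> 1" by simp
    finally show ?thesis .
  qed
  then have "(\<Sum>xs\<in>samples Z. \<Sum>J\<in>I. g J xs) \<le> real (card Z) ^ L"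
    using sum_bounded_above[of "samples Z" "\<lambda>xs. \<Sum>J\<in>I. g J xs" 1] by (simp add: card_samples Z)
  then have avg: "(\<Sum>J\<in>I. \<Sum>xs\<in>samples Z. g J xs) / real (card Z) ^ L \<le> 1"
    using cardZ by (subst sum.swap) simp
  have "(\<Sum>J\<in>I. measure_pmf.prob (learner_output q L A (G J))
             {H. proper_colorings q H = proper_colorings q (G J)})
     \<le> (\<Sum>J\<in>I. (\<Sum>xs\<in>samples Z. g J xs) / real (card Z) ^ L + real L * \<delta>)"
    by (intro sum_mono bound)
  also have "\<dots> = (\<Sum>J\<in>I. \<Sum>xs\<in>samples Z. g J xs) / real (card Z) ^ L + real (card I) * (real L * \<delta>)"
    by (simp add: sum.distrib sum_divide_distrib)
  finally show ?thesis using avg by simp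
qed

section \<open>Counting colorings of the chains\<close>

text \<open>Neither domain nor color range is fixed, so the condition applies unchanged to full
  colorings and to their restrictions to the non-link vertices. The two sides are constrained
  independently of each other.\<close>

definition constrained_colorings ::
    "nat \<Rightarrow> nat \<Rightarrow> nat \<Rightarrow> (side \<Rightarrow> nat) \<Rightarrow> (vertex \<Rightarrow> nat) set" where
  "constrained_colorings q m t \<kappa> = {f. \<forall>b. \<forall>i \<in> {1..m}.
     inj_on f (clique_set q b i) \<and> \<kappa> b \<notin> f ` clique_set q b i \<and> (\<forall>v \<in> indep_set t b i. f v = \<kappa> b)}"

definition chain_colorings ::
    "nat \<Rightarrow> nat \<Rightarrow> nat \<Rightarrow> (side \<Rightarrow> nat) \<Rightarrow> (vertex \<Rightarrow> nat) set" where
  "chain_colorings q m t \<kappa> = {f \<in> (chain_verts q m t \<rightarrow>\<^sub>E {1..q}) \<inter> constrained_colorings q m t \<kappa>.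
     \<forall>i \<in> {1..m}. f (Link i) \<notin> range \<kappa>}"

text \<open>The part of a chain coloring that remains when the link vertices are deleted; its number
  will turn out not to depend on \<open>\<kappa>\<close>.\<close>

definition core_colorings ::
    "nat \<Rightarrow> nat \<Rightarrow> nat \<Rightarrow> (side \<Rightarrow> nat) \<Rightarrow> (vertex \<Rightarrow> nat) set" where
  "core_colorings q m t \<kappa> =
     (chain_verts q m t - range Link \<rightarrow>\<^sub>E {1..q}) \<inter> constrained_colorings q m t \<kappa>"

text \<open>The value at link vertices is a dummy: only non-link vertices are recolored by
  side.\<close>

primrec vertex_side :: "vertex \<Rightarrow> side" where
  "vertex_side (Clique b i k) = b"
| "vertex_side (Indep b i k) = b"
| "vertex_side (Link i) = Unprimed"

lemma side_UNIV: "(UNIV :: side set) = {Unprimed, Primed}"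
  using side.exhaust by auto

lemma finite_chain_verts: "finite (chain_verts q m t)"
  by (simp add: chain_verts_def side_UNIV clique_set_def indep_set_def)

lemma clique_set_subset: "i \<in> {1..m} \<Longrightarrow> clique_set q b i \<subseteq> chain_verts q m t"
  unfolding chain_verts_def by blast

lemma indep_set_subset: "i \<in> {1..m} \<Longrightarrow> indep_set t b i \<subseteq> chain_verts q m t"
  unfolding chain_verts_def by blast

lemma Link_notin [simp]: "Link i \<notin> clique_set q b j" "Link i \<notin> indep_set t b j"
  by (auto simp: clique_set_def indep_set_def)

lemma Link_in_chain_verts: "Link i \<in> chain_verts q m t \<longleftrightarrow> i \<in> {1..m}"
  by (auto simp: chain_verts_def clique_set_def indep_set_def)

text \<open>Link vertices lie in no clique and no independent set, so restricting a coloring, or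
  gluing on colors for the links, does not affect the condition.\<close>

lemma constrained_colorings_cong:
  assumes "\<And>v. v \<in> chain_verts q m t - range Link \<Longrightarrow> f v = g v"
  shows "f \<in> constrained_colorings q m t \<kappa> \<longleftrightarrow> g \<in> constrained_colorings q m t \<kappa>"
proof -
  have "inj_on f (clique_set q b i) = inj_on g (clique_set q b i)"
    "f ` clique_set q b i = g ` clique_set q b i"
    "(\<forall>v \<in> indep_set t b i. f v = \<kappa> b) = (\<forall>v \<in> indep_set t b i. g v = \<kappa> b)"
    if "i \<in> {1..m}" for b i
  proof -
    have "f v = g v" if "v \<in> clique_set q b i \<or> v \<in> indep_set t b i" for v
      using that clique_set_subset[OF \<open>i \<in> {1..m}\<close>, of q b t]
        indep_set_subset[OF \<open>i \<in> {1..m}\<close>, of t b q]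
      by (intro assms) auto
    then show "inj_on f (clique_set q b i) = inj_on g (clique_set q b i)"
      "f ` clique_set q b i = g ` clique_set q b i"
      "(\<forall>v \<in> indep_set t b i. f v = \<kappa> b) = (\<forall>v \<in> indep_set t b i. g v = \<kappa> b)"
      by (auto intro!: inj_on_cong image_cong ball_cong)
  qed
  then show ?thesis
    unfolding constrained_colorings_def by simp
qed

lemma chain_coloringsD:
  assumes "f \<in> chain_colorings q m t \<kappa>" "i \<in> {1..m}"
  shows "inj_on f (clique_set q b i)"
    and "v \<in> clique_set q b i \<Longrightarrow> f v \<noteq> \<kappa> b"
    and "v \<in> indep_set t b i \<Longrightarrow> f v = \<kappa> b"
    and "f (Link i) \<noteq> \<kappa> b"
proof -
  have *: "f \<in> constrained_colorings q m t \<kappa>" "f (Link i) \<notin> range \<kappa>"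
    using assms by (auto simp: chain_colorings_def)
  then show "f (Link i) \<noteq> \<kappa> b" by blast
  have "inj_on f (clique_set q b i)" "\<kappa> b \<notin> f ` clique_set q b i" "\<forall>v \<in> indep_set t b i. f v = \<kappa> b"
    using *(1) assms(2) unfolding constrained_colorings_def by blast+
  then show "inj_on f (clique_set q b i)"
    "v \<in> clique_set q b i \<Longrightarrow> f v \<noteq> \<kappa> b" "v \<in> indep_set t b i \<Longrightarrow> f v = \<kappa> b"
    by (simp_all add: rev_image_eqI) force
qed

text \<open>Given \<open>\<kappa>\<close>, each of the \<open>m\<close> links only has to avoid the
  colors in \<open>range \<kappa>\<close>, independently of the other links and of the core. This
  factor is what separates equal from unequal side colors.\<close>

lemma card_chain_colorings:
  assumes "range \<kappa> \<subseteq> {1..q}"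
  shows "card (chain_colorings q m t \<kappa>) = card (core_colorings q m t \<kappa>) * (q - card (range \<kappa>)) ^ m"
proof -
  define V where "V = chain_verts q m t"
  define B where "B = V - range Link"
  define D where "D = (Link ` {1..m} \<rightarrow>\<^sub>E {1..q} - range \<kappa>)"
  have V: "V = B \<union> Link ` {1..m}" "B \<inter> Link ` {1..m} = {}"
    by (auto simp: B_def V_def Link_in_chain_verts)
  have core: "core_colorings q m t \<kappa> = (B \<rightarrow>\<^sub>E {1..q}) \<inter> constrained_colorings q m t \<kappa>"
    by (simp add: core_colorings_def B_def V_def)
  have "bij_betw (\<lambda>f. (restrict f B, restrict f (Link ` {1..m})))
      (chain_colorings q m t \<kappa>) (core_colorings q m t \<kappa> \<times> D)"
  proof (rule bij_betw_byWitness[where f' = "\<lambda>(g, h) v. if v \<in> B then g v else h v"])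
    show "\<forall>f \<in> chain_colorings q m t \<kappa>.
      (\<lambda>(g, h) v. if v \<in> B then g v else h v) (restrict f B, restrict f (Link ` {1..m})) = f"
      using V by (fastforce simp: chain_colorings_def V_def[symmetric] PiE_iff extensional_def restrict_def)
    show "\<forall>p \<in> core_colorings q m t \<kappa> \<times> D.
      (\<lambda>f. (restrict f B, restrict f (Link ` {1..m})))
        ((\<lambda>(g, h) v. if v \<in> B then g v else h v) p) = p"
      using V(2) by (auto simp: core D_def PiE_iff extensional_def restrict_def fun_eq_iff)
    show "(\<lambda>f. (restrict f B, restrict f (Link ` {1..m}))) ` chain_colorings q m t \<kappa>
      \<subseteq> core_colorings q m t \<kappa> \<times> D"
    proof safe
      fix f assume f: "f \<in> chain_colorings q m t \<kappa>"
      have "restrict f B \<in> constrained_colorings q m t \<kappa>"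
        using f constrained_colorings_cong[of q m t "restrict f B" f]
        by (simp add: chain_colorings_def B_def V_def)
      then show "restrict f B \<in> core_colorings q m t \<kappa>"
        using f V(1) by (auto simp: core chain_colorings_def V_def[symmetric])
      show "restrict f (Link ` {1..m}) \<in> D"
        using f V(1) by (auto simp: D_def chain_colorings_def V_def[symmetric] PiE_iff)
    qed
    show "(\<lambda>(g, h) v. if v \<in> B then g v else h v) ` (core_colorings q m t \<kappa> \<times> D)
      \<subseteq> chain_colorings q m t \<kappa>"
    proof safe
      fix g h assume g: "g \<in> core_colorings q m t \<kappa>" and h: "h \<in> D"
      define f where "f v = (if v \<in> B then g v else h v)" for v
      have "f \<in> constrained_colorings q m t \<kappa>"
        using g constrained_colorings_cong[of q m t f g]
        by (simp add: core f_def B_def V_def)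
      moreover have "f \<in> V \<rightarrow>\<^sub>E {1..q}"
        using g h V by (auto simp: f_def core D_def PiE_iff extensional_def)
      moreover have "f (Link i) \<notin> range \<kappa>" if "i \<in> {1..m}" for i
        using h that by (auto simp: f_def D_def PiE_iff B_def)
      ultimately show "(\<lambda>v. if v \<in> B then g v else h v) \<in> chain_colorings q m t \<kappa>"
        by (simp add: chain_colorings_def V_def[symmetric] f_def[abs_def])
    qed
  qed
  then have "card (chain_colorings q m t \<kappa>) = card (core_colorings q m t \<kappa>) * card D"
    by (simp add: bij_betw_same_card card_cartesian_product)
  also have "card D = (q - card (range \<kappa>)) ^ m"
    using assms by (simp add: D_def card_PiE card_image inj_on_def card_Diff_subset side_UNIV)
  finally show ?thesis .
qed

text \<open>Swapping the colors \<open>\<kappa> b\<close> and \<open>\<kappa>' b\<close> on side \<open>b\<close> exchanges the two sets.\<close>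
lemma card_core_colorings_le:
  assumes "range \<kappa> \<subseteq> {1..q}" "range \<kappa>' \<subseteq> {1..q}"
  shows "card (core_colorings q m t \<kappa>) \<le> card (core_colorings q m t \<kappa>')"
proof -
  define B where "B = chain_verts q m t - range Link"
  define \<tau> where "\<tau> b = Transposition.transpose (\<kappa> b) (\<kappa>' b)" for b
  \<comment> \<open>Each side gets its own transposition. This is harmless because no core
    constraint relates vertices of different sides.\<close>
  define \<Phi> where "\<Phi> g = restrict (\<lambda>v. \<tau> (vertex_side v) (g v)) B" for g
  have \<tau>: "\<tau> b c = \<tau> b c' \<longleftrightarrow> c = c'" "\<tau> b (\<kappa> b) = \<kappa>' b" for b c c'
    unfolding \<tau>_def by (metis transpose_involutory) simp
  have \<tau>_range: "\<tau> b c \<in> {1..q}" if "c \<in> {1..q}" for b c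
    using that assms[THEN subsetD, OF rangeI, of b] by (auto simp: \<tau>_def Transposition.transpose_def)
  have "inj_on \<Phi> (core_colorings q m t \<kappa>)"
  proof (rule inj_onI)
    fix g h assume gh: "g \<in> core_colorings q m t \<kappa>" "h \<in> core_colorings q m t \<kappa>" "\<Phi> g = \<Phi> h"
    have "g v = h v" if "v \<in> B" for v
      using fun_cong[OF gh(3), of v] that by (simp add: \<Phi>_def \<tau>)
    moreover have "g \<in> B \<rightarrow>\<^sub>E {1..q}" "h \<in> B \<rightarrow>\<^sub>E {1..q}"
      using gh(1,2) by (simp_all add: core_colorings_def B_def)
    ultimately show "g = h" by (intro PiE_ext)
  qed
  moreover have "\<Phi> ` core_colorings q m t \<kappa> \<subseteq> core_colorings q m t \<kappa>'"
  proof safe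
    fix g assume g: "g \<in> core_colorings q m t \<kappa>"
    have "\<Phi> g \<in> B \<rightarrow>\<^sub>E {1..q}"
      using g \<tau>_range by (auto simp: core_colorings_def \<Phi>_def B_def[symmetric] PiE_iff)
    moreover have "(\<lambda>v. \<tau> (vertex_side v) (g v)) \<in> constrained_colorings q m t \<kappa>'"
    proof -
      have side: "vertex_side v = b" if "v \<in> clique_set q b i \<or> v \<in> indep_set t b i" for v b i
        using that by (auto simp: clique_set_def indep_set_def)
      show ?thesis
        unfolding constrained_colorings_def
      proof safe
        fix b i assume "i \<in> {1..m}"
        with g have gi: "inj_on g (clique_set q b i)" "\<kappa> b \<notin> g ` clique_set q b i"
            "\<forall>v \<in> indep_set t b i. g v = \<kappa> b"
          unfolding core_colorings_def constrained_colorings_def by blast+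
        show "inj_on (\<lambda>v. \<tau> (vertex_side v) (g v)) (clique_set q b i)"
        proof (rule inj_onI)
          fix u v assume "u \<in> clique_set q b i" "v \<in> clique_set q b i"
            "\<tau> (vertex_side u) (g u) = \<tau> (vertex_side v) (g v)"
          with gi(1) show "u = v" by (simp add: side[of _ b i] \<tau>(1) inj_on_eq_iff)
        qed
        show False if "\<kappa>' b = \<tau> (vertex_side v) (g v)" "v \<in> clique_set q b i" for v
        proof -
          have "\<tau> b (\<kappa> b) = \<tau> b (g v)" using that by (simp add: side[of v b i] \<tau>(2))
          then show False using that gi(2) by (simp add: \<tau>(1))
        qed
        show "\<tau> (vertex_side v) (g v) = \<kappa>' b" if "v \<in> indep_set t b i" for v
          using that gi(3) by (simp add: side[of v b i] \<tau>(2))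
      qed
    qed
    then have "\<Phi> g \<in> constrained_colorings q m t \<kappa>'"
      using constrained_colorings_cong[of q m t "\<Phi> g" "\<lambda>v. \<tau> (vertex_side v) (g v)"]
      by (simp add: \<Phi>_def B_def)
    ultimately show "\<Phi> g \<in> core_colorings q m t \<kappa>'"
      by (simp add: core_colorings_def B_def)
  qed
  moreover have "finite (core_colorings q m t \<kappa>')"
    unfolding core_colorings_def by (intro finite_Int disjI1 finite_PiE) (simp_all add: finite_chain_verts)
  ultimately show ?thesis
    by (meson card_inj_on_le)
qed

section \<open>Edges of the chain and the colorings they force\<close>

lemma chain_edges_iff: "e \<in> chain_edges q m t P a \<longleftrightarrow>
    (\<exists>b. \<exists>i\<in>{1..m}. \<exists>u\<in>clique_set q b i. \<exists>v\<in>clique_set q b i. u \<noteq> v \<and> e = {u, v}) \<or>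
    (\<exists>b. \<exists>i\<in>{1..m}. \<exists>u\<in>clique_set q b i. \<exists>v\<in>indep_set t b i. e = {u, v}) \<or>
    (\<exists>b. \<exists>i\<in>{2..m}. \<exists>j\<in>{1..t}. \<exists>v\<in>P b i j. e = {Indep b (i - 1) j, v}) \<or>
    (\<exists>b. \<exists>i\<in>{1..m}. e = {Link i, a b i})"
  (is "_ \<longleftrightarrow> ?A \<or> ?B \<or> ?C \<or> ?D")
proof -
  have "e \<in> {{u, v} | b i u v. i \<in> {1..m} \<and> u \<in> clique_set q b i \<and> v \<in> clique_set q b i \<and> u \<noteq> v} \<longleftrightarrow> ?A"
    by blast
  moreover have "e \<in> {{u, v} | b i u v. i \<in> {1..m} \<and> u \<in> clique_set q b i \<and> v \<in> indep_set t b i} \<longleftrightarrow> ?B"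
    by blast
  moreover have "e \<in> {{Indep b (i - 1) j, v} | b i j v. i \<in> {2..m} \<and> j \<in> {1..t} \<and> v \<in> P b i j} \<longleftrightarrow> ?C"
    by blast
  moreover have "e \<in> {{Link i, a b i} | b i. i \<in> {1..m}} \<longleftrightarrow> ?D"
    by blast
  ultimately show ?thesis
    unfolding chain_edges_def by (simp only: Un_iff disj_assoc)
qed

lemma indep_clique_edge:
  assumes "i \<in> {2..m}" "j \<in> {1..t}" "v \<in> P b i j"
  shows "{Indep b (i - 1) j, v} \<in> chain_edges q m t P a"
  unfolding chain_edges_def using assms by (intro UnI1 UnI2 CollectI exI conjI) auto

locale chain_construction =
  fixes q m t :: nat
    and P :: "side \<Rightarrow> nat \<Rightarrow> nat \<Rightarrow> vertex set"
    and a :: "side \<Rightarrow> nat \<Rightarrow> vertex"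
    and x y :: "nat \<Rightarrow> vertex"
  assumes q: "q \<ge> 3" and m: "m \<ge> 1" and t: "t \<ge> 1"
    and partitions: "balanced_partitions q m t P"
    and a: "\<And>b i. i \<in> {1..m} \<Longrightarrow> a b i \<in> indep_set t b i"
    and x: "\<And>i. i \<in> {1..m} \<Longrightarrow> x i \<in> clique_set q Unprimed i"
    and y: "\<And>i. i \<in> {1..m} \<Longrightarrow> y i \<in> indep_set t Primed i"
begin

definition graph :: "nat set \<Rightarrow> vertex graph" where
  "graph J = (chain_verts q m t, chain_edges q m t P a \<union> {{x i, y i} | i. i \<in> J})"

text \<open>The uninformative samples: these take the role of \<open>Z\<close> in
  \<open>sum_success_prob_le\<close>.\<close>

definition monochromatic_colorings :: "(vertex \<Rightarrow> nat) set" where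
  "monochromatic_colorings = (\<Union>c \<in> {1..q}. chain_colorings q m t (\<lambda>_. c))"

lemma P_cover: "i \<in> {2..m} \<Longrightarrow> (\<Union>j \<in> {1..t}. P b i j) = clique_set q b i"
  using partitions by (auto simp: balanced_partitions_def)

text \<open>The colors \<open>\<kappa> b\<close> are read off at the first vertex of the first
  independent set on each side and propagated by induction on \<open>i\<close>.\<close>

lemma chain_colorings_forced:
  assumes f: "f \<in> chain_verts q m t \<rightarrow>\<^sub>E {1..q}"
    and proper: "\<And>u v. {u, v} \<in> chain_edges q m t P a \<Longrightarrow> f u \<noteq> f v"
  shows "f \<in> chain_colorings q m t (\<lambda>b. f (Indep b 1 1))"
proof -
  define \<kappa> where "\<kappa> b = f (Indep b 1 1)" for b
  have inj: "inj_on f (clique_set q b i)" if "i \<in> {1..m}" for b i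
  proof (rule inj_onI)
    fix u v assume uv: "u \<in> clique_set q b i" "v \<in> clique_set q b i" "f u = f v"
    show "u = v"
    proof (rule ccontr)
      assume "u \<noteq> v"
      then have "{u, v} \<in> chain_edges q m t P a" using uv that unfolding chain_edges_iff by blast
      with proper uv show False by blast
    qed
  qed
  have range: "f v \<in> {1..q}" if "v \<in> clique_set q b i \<or> v \<in> indep_set t b i" "i \<in> {1..m}" for v b i
    using f that clique_set_subset[of i m q b t] indep_set_subset[of i m t b q] by blast
  have clique_indep: "f u \<noteq> f v"
    if "u \<in> clique_set q b i" "v \<in> indep_set t b i" "i \<in> {1..m}" for u v b i
  proof -
    have "{u, v} \<in> chain_edges q m t P a" using that unfolding chain_edges_iff by blast
    with proper show ?thesis by blast
  qed
  \<comment> \<open>The clique uses \<open>q - 1\<close> distinct colors out of \<open>q\<close>, so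
    exactly one is left over, and every vertex of the adjacent independent set must take it.\<close>
  have missing: "f v = c"
    if i: "i \<in> {1..m}" and c: "c \<in> {1..q} - f ` clique_set q b i" and v: "v \<in> indep_set t b i" for b i c v
  proof -
    have "card (f ` clique_set q b i) = q - 1"
      using inj[OF i] by (simp add: card_image clique_set_def inj_on_def)
    moreover have "f ` clique_set q b i \<subseteq> {1..q}"
      using range i by blast
    ultimately have "card ({1..q} - f ` clique_set q b i) = 1"
      using q by (simp add: card_Diff_subset clique_set_def)
    moreover have "f v \<in> {1..q} - f ` clique_set q b i"
      using range[of v b i] clique_indep[of _ b i v] i v by (force simp: image_iff)
    ultimately show ?thesis
      using c by (metis card_1_singletonE singletonD)
  qed
  have first: "Indep b 1 1 \<in> indep_set t b 1" for b
    using t by (simp add: indep_set_def)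
  have \<kappa>_range: "\<kappa> b \<in> {1..q}" for b
    using range[OF disjI2[OF first]] m by (simp add: \<kappa>_def)
  have level: "\<kappa> b \<notin> f ` clique_set q b i \<and> (\<forall>v\<in>indep_set t b i. f v = \<kappa> b)"
    if "1 \<le> i" "i \<le> m" for b i
    using that
  proof (induction i rule: nat_induct_at_least)
    case base
    then have "\<kappa> b \<notin> f ` clique_set q b 1"
      using clique_indep[OF _ first[of b]] by (force simp: \<kappa>_def)
    moreover from this have "f v = \<kappa> b" if "v \<in> indep_set t b 1" for v
      using that \<kappa>_range[of b] base by (intro missing[of 1]) auto
    ultimately show ?case by blast
  next
    case (Suc i)
    \<comment> \<open>Since the parts cover the next clique, each of its vertices has a neighbor in
      the preceding independent set, where the color is \<open>\<kappa> b\<close> by induction.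
      Hence \<open>\<kappa> b\<close> is the color omitted by this clique too.\<close>
    have "f v \<noteq> \<kappa> b" if "v \<in> clique_set q b (Suc i)" for v
    proof -
      have Suc_i: "Suc i \<in> {2..m}" using Suc.hyps Suc.prems by simp
      have "v \<in> (\<Union>j \<in> {1..t}. P b (Suc i) j)"
        using that unfolding P_cover[OF Suc_i] .
      then obtain j where j: "j \<in> {1..t}" "v \<in> P b (Suc i) j"
        by (rule UN_E)
      then have "{Indep b (Suc i - 1) j, v} \<in> chain_edges q m t P a"
        using Suc_i by (intro indep_clique_edge)
      then have "f (Indep b i j) \<noteq> f v" using proper by simp
      then show ?thesis
        using Suc j by (auto simp: indep_set_def)
    qed
    then have "\<kappa> b \<notin> f ` clique_set q b (Suc i)" by (metis imageE)
    moreover from this have "f v = \<kappa> b" if "v \<in> indep_set t b (Suc i)" for v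
      using that \<kappa>_range[of b] Suc.prems by (intro missing[of "Suc i"]) auto
    ultimately show ?case by blast
  qed
  have "f (Link i) \<notin> range \<kappa>" if i: "i \<in> {1..m}" for i
  proof
    assume "f (Link i) \<in> range \<kappa>"
    then obtain b where "f (Link i) = \<kappa> b" by auto
    moreover have "f (a b i) = \<kappa> b" using level i a by auto
    moreover have "{Link i, a b i} \<in> chain_edges q m t P a"
      using i unfolding chain_edges_iff by blast
    ultimately show False using proper by metis
  qed
  with f inj level have "f \<in> chain_colorings q m t \<kappa>"
    by (auto simp: chain_colorings_def constrained_colorings_def)
  then show ?thesis by (simp add: \<kappa>_def[abs_def])
qed

text \<open>Converse to \<open>chain_colorings_forced\<close>: together they identify the proper
  colorings of the chain without matching edges.\<close>

lemma chain_colorings_proper: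
  assumes f: "f \<in> chain_colorings q m t \<kappa>" and e: "{u, v} \<in> chain_edges q m t P a"
  shows "f u \<noteq> f v"
proof -
  have inj: "inj_on f (clique_set q b i)" and clique: "\<And>w. w \<in> clique_set q b i \<Longrightarrow> f w \<noteq> \<kappa> b"
    and indep: "\<And>w. w \<in> indep_set t b i \<Longrightarrow> f w = \<kappa> b" and link: "f (Link i) \<noteq> \<kappa> b"
    if "i \<in> {1..m}" for b i
    using chain_coloringsD[OF f that] by auto
  from e consider
      b i u' v' where "i \<in> {1..m}" "u' \<in> clique_set q b i" "v' \<in> clique_set q b i" "u' \<noteq> v'" "{u, v} = {u', v'}"
    | b i u' v' where "i \<in> {1..m}" "u' \<in> clique_set q b i" "v' \<in> indep_set t b i" "{u, v} = {u', v'}"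
    | b i j v' where "i \<in> {2..m}" "j \<in> {1..t}" "v' \<in> P b i j" "{u, v} = {Indep b (i - 1) j, v'}"
    | b i where "i \<in> {1..m}" "{u, v} = {Link i, a b i}"
    unfolding chain_edges_iff by blast
  then show ?thesis
  proof cases
    case 1
    then have "f u' \<noteq> f v'" using inj by (meson inj_onD)
    with 1 show ?thesis by (auto simp: doubleton_eq_iff)
  next
    case 2
    then have "f u' \<noteq> f v'" using clique indep by metis
    with 2 show ?thesis by (auto simp: doubleton_eq_iff)
  next
    case 3
    then have "v' \<in> clique_set q b i" "i \<in> {1..m}" "i - 1 \<in> {1..m}" "Indep b (i - 1) j \<in> indep_set t b (i - 1)"
      using P_cover[of i b] by (auto simp: indep_set_def)
    then have "f (Indep b (i - 1) j) \<noteq> f v'" using clique indep by metis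
    with 3 show ?thesis by (auto simp: doubleton_eq_iff)
  next
    case 4
    then have "f (Link i) \<noteq> f (a b i)" using link indep a by metis
    with 4 show ?thesis by (auto simp: doubleton_eq_iff)
  qed
qed

text \<open>As \<open>y i\<close> lies in a primed independent set, its color is always
  \<open>\<kappa> Primed\<close>, so the matching edge at \<open>i\<close> becomes a condition on
  \<open>x i\<close> alone.\<close>

lemma proper_colorings_graph:
  assumes "J \<subseteq> {1..m}"
  shows "proper_colorings q (graph J) =
    {f. \<exists>\<kappa>. f \<in> chain_colorings q m t \<kappa> \<and> (\<forall>i\<in>J. f (x i) \<noteq> \<kappa> Primed)}"
proof -
  have yi: "f (y i) = \<kappa> Primed" if "f \<in> chain_colorings q m t \<kappa>" "i \<in> J" for f \<kappa> i
    using that assms y chain_coloringsD(3) by blast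
  show ?thesis
  proof safe
    fix f assume "f \<in> proper_colorings q (graph J)"
    then have f: "f \<in> chain_verts q m t \<rightarrow>\<^sub>E {1..q}"
        "\<And>u v. {u, v} \<in> chain_edges q m t P a \<union> {{x i, y i} | i. i \<in> J} \<Longrightarrow> f u \<noteq> f v"
      by (auto simp: proper_colorings_def graph_def)
    then have *: "f \<in> chain_colorings q m t (\<lambda>b. f (Indep b 1 1))"
      by (intro chain_colorings_forced) auto
    moreover have "\<forall>i\<in>J. f (x i) \<noteq> f (Indep Primed 1 1)"
      using f(2) yi[OF *] by (metis (mono_tags, lifting) UnI2 mem_Collect_eq)
    ultimately show "\<exists>\<kappa>. f \<in> chain_colorings q m t \<kappa> \<and> (\<forall>i\<in>J. f (x i) \<noteq> \<kappa> Primed)"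
      by blast
  next
    fix f \<kappa> assume f: "f \<in> chain_colorings q m t \<kappa>" "\<forall>i\<in>J. f (x i) \<noteq> \<kappa> Primed"
    have "f u \<noteq> f v" if "{u, v} \<in> {{x i, y i} | i. i \<in> J}" for u v
      using that f yi[OF f(1)] by (auto simp: doubleton_eq_iff)
    then show "f \<in> proper_colorings q (graph J)"
      using f chain_colorings_proper[OF f(1)]
      by (auto simp: proper_colorings_def graph_def chain_colorings_def)
  qed
qed

text \<open>The clique of \<open>x i\<close> omits the color of its own side, which here is also the
  primed color; thus every matching edge is respected automatically.\<close>

lemma monochromatic_colorings_subset:
  assumes "J \<subseteq> {1..m}"
  shows "monochromatic_colorings \<subseteq> proper_colorings q (graph J)"
proof
  fix f assume "f \<in> monochromatic_colorings"
  then obtain c where f: "f \<in> chain_colorings q m t (\<lambda>_. c)"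
    by (auto simp: monochromatic_colorings_def)
  then have "\<forall>i\<in>J. f (x i) \<noteq> c"
    using assms x chain_coloringsD(2)[OF f] by blast
  with f show "f \<in> proper_colorings q (graph J)"
    by (auto simp: proper_colorings_graph[OF assms])
qed

lemma finite_proper_colorings: "finite (proper_colorings q (graph J))"
  by (rule finite_subset[of _ "chain_verts q m t \<rightarrow>\<^sub>E {1..q}"])
     (auto simp: proper_colorings_def graph_def intro!: finite_PiE finite_chain_verts)

lemma finite_chain_colorings: "finite (chain_colorings q m t \<kappa>)"
  by (rule finite_subset[of _ "chain_verts q m t \<rightarrow>\<^sub>E {1..q}"])
     (auto simp: chain_colorings_def intro!: finite_PiE finite_chain_verts)

text \<open>A coloring determines its \<open>\<kappa>\<close>, so the sets
  \<open>chain_colorings q m t \<kappa>\<close> for different \<open>\<kappa>\<close> are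
  disjoint.\<close>

lemma chain_colorings_color:
  assumes "f \<in> chain_colorings q m t \<kappa>"
  shows "\<kappa> b = f (Indep b 1 1)" "\<kappa> b \<in> {1..q}"
proof -
  have "Indep b 1 1 \<in> indep_set t b 1" using t by (simp add: indep_set_def)
  moreover have "Indep b 1 1 \<in> chain_verts q m t" using indep_set_subset[of 1 m t b q] calculation m by auto
  ultimately show "\<kappa> b = f (Indep b 1 1)" "\<kappa> b \<in> {1..q}"
    using assms m chain_coloringsD(3)[OF assms, of 1 "Indep b 1 1" b]
    by (auto simp: chain_colorings_def dest: PiE_mem[of f _ _ "Indep b 1 1"])
qed

text \<open>
  This coloring violates exactly the edge \<open>{x i\<^sub>0, y i\<^sub>0}\<close> of the matching: color \<open>1\<close>, the one
  of the primed independent sets, occurs at \<open>x i\<^sub>0\<close> and at no other \<open>x i\<close>.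
\<close>
lemma separating_coloring:
  obtains f \<kappa> where "f \<in> chain_colorings q m t \<kappa>" "\<And>i. i \<in> {1..m} \<Longrightarrow> f (x i) = \<kappa> Primed \<longleftrightarrow> i = i\<^sub>0"
proof -
  have "\<exists>k. \<forall>i\<in>{1..m}. k i \<in> {1..q - 1} \<and> x i = Clique Unprimed i (k i)"
    using x unfolding clique_set_def by (intro bchoice) blast
  then obtain k where k: "\<And>i. i \<in> {1..m} \<Longrightarrow> k i \<in> {1..q - 1} \<and> x i = Clique Unprimed i (k i)"
    by blast
  \<comment> \<open>Unprimed cliques use the colors \<open>1\<close> to \<open>q - 1\<close> and
    primed cliques \<open>2\<close> to \<open>q\<close>, which explains the shift
    \<open>j + 1\<close> below. Links get color \<open>2\<close>, different from \<open>1\<close>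
    and \<open>q\<close> because \<open>q \<ge> 3\<close>.\<close>
  define \<kappa> where "\<kappa> b = (case b of Unprimed \<Rightarrow> q | Primed \<Rightarrow> 1)" for b
  \<comment> \<open>The transposition gives \<open>x i\<close> the color \<open>1\<close> if
    \<open>i = i\<^sub>0\<close> and \<open>2\<close> otherwise, while the clique still uses exactly
    the colors \<open>1\<close> to \<open>q - 1\<close>.\<close>
  define \<tau> where "\<tau> i = Transposition.transpose (k i) (if i = i\<^sub>0 then 1 else 2)" for i
  define g where "g v = (case v of
      Clique b i j \<Rightarrow> (case b of Unprimed \<Rightarrow> \<tau> i j | Primed \<Rightarrow> j + 1)
    | Indep b i j \<Rightarrow> \<kappa> b
    | Link i \<Rightarrow> 2)" for v
  define f where "f = restrict g (chain_verts q m t)"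
  have \<tau>_range: "\<tau> i j \<in> {1..q - 1}" if "i \<in> {1..m}" "j \<in> {1..q - 1}" for i j
    using that k[of i] q by (auto simp: \<tau>_def Transposition.transpose_def)
  have \<tau>_inj: "\<tau> i j = \<tau> i j' \<longleftrightarrow> j = j'" for i j j'
    unfolding \<tau>_def by (metis transpose_involutory)
  have "g \<in> constrained_colorings q m t \<kappa>"
    unfolding constrained_colorings_def
  proof safe
    fix b i assume i: "i \<in> {1..m}"
    show "inj_on g (clique_set q b i)"
      by (cases b) (auto simp: inj_on_def clique_set_def g_def \<tau>_inj)
    show "g v = \<kappa> b" if "v \<in> indep_set t b i" for v
      using that by (auto simp: indep_set_def g_def)
    show False if "\<kappa> b = g v" "v \<in> clique_set q b i" for v
      using that \<tau>_range[OF i] q by (cases b) (fastforce simp: clique_set_def g_def \<kappa>_def)+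
  qed
  then have "f \<in> constrained_colorings q m t \<kappa>"
    using constrained_colorings_cong[of q m t f g] by (simp add: f_def)
  moreover have "g v \<in> {1..q}" if "v \<in> chain_verts q m t" for v
  proof (cases v)
    case (Clique b i j)
    with that have "i \<in> {1..m}" "j \<in> {1..q - 1}"
      by (auto simp: chain_verts_def clique_set_def indep_set_def)
    with Clique \<tau>_range[of i j] q show ?thesis
      by (cases b) (auto simp: g_def)
  next
    case (Indep b i j)
    with q show ?thesis by (cases b) (auto simp: g_def \<kappa>_def)
  next
    case (Link i)
    with q show ?thesis by (simp add: g_def)
  qed
  moreover have "f (Link i) \<notin> range \<kappa>" if "i \<in> {1..m}" for i
    using that q by (auto simp: f_def g_def \<kappa>_def Link_in_chain_verts side_UNIV)
  ultimately have "f \<in> chain_colorings q m t \<kappa>"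
    by (auto simp: chain_colorings_def f_def)
  moreover have "f (x i) = \<kappa> Primed \<longleftrightarrow> i = i\<^sub>0" if "i \<in> {1..m}" for i
  proof -
    have "x i \<in> chain_verts q m t" using x[OF that] clique_set_subset[OF that] by auto
    then show ?thesis using k[OF that] by (simp add: f_def g_def \<tau>_def \<kappa>_def)
  qed
  ultimately show thesis by (rule that)
qed

text \<open>If \<open>i\<close> is in \<open>J\<close> but not in \<open>J'\<close>, the coloring
  that violates only the matching edge at \<open>i\<close> is proper for \<open>J'\<close> and not
  for \<open>J\<close>.\<close>

lemma inj_on_proper_colorings: "inj_on (\<lambda>J. proper_colorings q (graph J)) (Pow {1..m})"
proof -
  have "J \<subseteq> J'" if J: "J \<subseteq> {1..m}" "J' \<subseteq> {1..m}"
    and eq: "proper_colorings q (graph J) = proper_colorings q (graph J')" for J J'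
  proof (rule ccontr)
    assume "\<not> J \<subseteq> J'"
    then obtain i where i: "i \<in> J" "i \<notin> J'" by auto
    obtain f \<kappa> where f: "f \<in> chain_colorings q m t \<kappa>"
      and fx: "\<And>i'. i' \<in> {1..m} \<Longrightarrow> f (x i') = \<kappa> Primed \<longleftrightarrow> i' = i"
      using separating_coloring by blast
    have "\<forall>i'\<in>J'. f (x i') \<noteq> \<kappa> Primed"
      using fx i J by auto
    with f have "f \<in> proper_colorings q (graph J')"
      unfolding proper_colorings_graph[OF J(2)] by blast
    then obtain \<kappa>' where f': "f \<in> chain_colorings q m t \<kappa>'" and "f (x i) \<noteq> \<kappa>' Primed"
      using i unfolding eq[symmetric] proper_colorings_graph[OF J(1)] by blast
    moreover have "f (x i) = \<kappa> Primed"
      using fx[of i] i J by blast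
    ultimately show False
      using f[THEN chain_colorings_color(1), of Primed] f'[THEN chain_colorings_color(1), of Primed]
      by simp
  qed
  then show ?thesis by (intro inj_onI equalityI) auto
qed

text \<open>With \<open>K\<close> core colorings for each \<open>\<kappa>\<close>, the
  \<open>q\<close> constant choices give \<open>K * (q - 1) ^ m\<close> colorings each, and the
  \<open>q * (q - 1)\<close> ordered pairs of distinct colors at most \<open>K * (q - 2) ^ m\<close>
  each. The bound is the ratio of the two totals.\<close>

lemma card_mixed_colorings_le:
  assumes J: "J \<subseteq> {1..m}"
  shows "real (card (proper_colorings q (graph J) - monochromatic_colorings))
    \<le> real (q - 1) * (real (q - 2) / real (q - 1)) ^ m * real (card monochromatic_colorings)"
    and "monochromatic_colorings \<noteq> {}"
proof -
  define K where "K = card (core_colorings q m t (\<lambda>_. 1))"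
  have core: "card (core_colorings q m t \<kappa>) = K" if "range \<kappa> \<subseteq> {1..q}" for \<kappa>
    using card_core_colorings_le[of \<kappa> q "\<lambda>_. 1"] card_core_colorings_le[of "\<lambda>_. 1" q \<kappa>] that q
    by (simp add: K_def le_antisym)
  have mono: "card monochromatic_colorings = q * (K * (q - 1) ^ m)"
  proof -
    have "card monochromatic_colorings = (\<Sum>c\<in>{1..q}. card (chain_colorings q m t (\<lambda>_. c)))"
      unfolding monochromatic_colorings_def
    proof (intro card_UN_disjoint ballI impI)
      fix c c' :: nat assume "c \<noteq> c'"
      have False if "f \<in> chain_colorings q m t (\<lambda>_. c)" "f \<in> chain_colorings q m t (\<lambda>_. c')" for f
        using that[THEN chain_colorings_color(1)] \<open>c \<noteq> c'\<close> by simp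
      then show "chain_colorings q m t (\<lambda>_. c) \<inter> chain_colorings q m t (\<lambda>_. c') = {}"
        by blast
    qed (simp_all add: finite_chain_colorings)
    also have "\<dots> = (\<Sum>c\<in>{1..q}. K * (q - 1) ^ m)"
      by (intro sum.cong refl) (auto simp: card_chain_colorings core)
    finally show ?thesis by simp
  qed
  define pairs where "pairs = Sigma {1..q} (\<lambda>c. {1..q} - {c})"
  define \<kappa> where "\<kappa> p = case_side (fst p) (snd p)" for p :: "nat \<times> nat"
  have range_\<kappa>: "range (\<kappa> p) = {fst p, snd p}" for p
    by (simp add: \<kappa>_def side_UNIV)
  \<comment> \<open>The matching conditions are dropped here, which makes the upper bound uniform in
    \<open>J\<close>.\<close>
  have "proper_colorings q (graph J) - monochromatic_colorings \<subseteq> (\<Union>p\<in>pairs. chain_colorings q m t (\<kappa> p))"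
  proof
    fix f assume f: "f \<in> proper_colorings q (graph J) - monochromatic_colorings"
    then obtain \<kappa>' where \<kappa>': "f \<in> chain_colorings q m t \<kappa>'"
      by (auto simp: proper_colorings_graph[OF J])
    have "\<kappa>' Unprimed \<noteq> \<kappa>' Primed"
    proof
      assume "\<kappa>' Unprimed = \<kappa>' Primed"
      then have "\<kappa>' = (\<lambda>_. \<kappa>' Primed)" by (metis side.exhaust)
      with \<kappa>' chain_colorings_color(2)[OF \<kappa>', of Primed] have "f \<in> monochromatic_colorings"
        unfolding monochromatic_colorings_def by (metis UN_I)
      with f show False by simp
    qed
    then have "(\<kappa>' Unprimed, \<kappa>' Primed) \<in> pairs"
      using chain_colorings_color(2)[OF \<kappa>'] by (auto simp: pairs_def)
    moreover have "\<kappa>' = \<kappa> (\<kappa>' Unprimed, \<kappa>' Primed)"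
      by (auto simp: \<kappa>_def fun_eq_iff split: side.split)
    ultimately show "f \<in> (\<Union>p\<in>pairs. chain_colorings q m t (\<kappa> p))"
      using \<kappa>' by (metis UN_I)
  qed
  moreover have fin: "finite pairs" by (simp add: pairs_def)
  ultimately have "card (proper_colorings q (graph J) - monochromatic_colorings)
      \<le> card (\<Union>p\<in>pairs. chain_colorings q m t (\<kappa> p))"
    by (intro card_mono finite_UN_I finite_chain_colorings)
  also have "\<dots> \<le> (\<Sum>p\<in>pairs. card (chain_colorings q m t (\<kappa> p)))"
    by (rule card_UN_le[OF fin])
  also have "\<dots> = (\<Sum>p\<in>pairs. K * (q - 2) ^ m)"
  proof (intro sum.cong refl)
    fix p assume p: "p \<in> pairs"
    then have "fst p \<noteq> snd p" "range (\<kappa> p) \<subseteq> {1..q}"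
      unfolding range_\<kappa> by (auto simp: pairs_def)
    moreover from this have "card (range (\<kappa> p)) = 2" by (simp add: range_\<kappa>)
    ultimately show "card (chain_colorings q m t (\<kappa> p)) = K * (q - 2) ^ m"
      by (simp add: card_chain_colorings core)
  qed
  also have "\<dots> = q * (q - 1) * (K * (q - 2) ^ m)"
    by (simp add: pairs_def card_SigmaI)
  finally have "real (card (proper_colorings q (graph J) - monochromatic_colorings))
      \<le> real (q * (q - 1) * (K * (q - 2) ^ m))"
    by (rule of_nat_mono)
  also have "\<dots> = real (q - 1) * (real (q - 2) / real (q - 1)) ^ m * real (card monochromatic_colorings)"
    using q by (simp add: mono power_divide)
  finally show "real (card (proper_colorings q (graph J) - monochromatic_colorings))
    \<le> real (q - 1) * (real (q - 2) / real (q - 1)) ^ m * real (card monochromatic_colorings)" .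
  \<comment> \<open>A single chain coloring, for whatever \<open>\<kappa>\<close>, shows
    \<open>K > 0\<close>, and \<open>K\<close> also counts the cores of monochromatic
    colorings.\<close>
  obtain f \<kappa> where f: "f \<in> chain_colorings q m t \<kappa>"
    by (rule separating_coloring[of 1])
  then have "chain_colorings q m t \<kappa> \<noteq> {}" by blast
  then have "card (chain_colorings q m t \<kappa>) > 0"
    using finite_chain_colorings card_gt_0_iff by blast
  moreover have "range \<kappa> \<subseteq> {1..q}"
    using chain_colorings_color(2)[OF f] by blast
  ultimately have "K * (q - card (range \<kappa>)) ^ m > 0"
    by (simp only: card_chain_colorings core)
  then have "K > 0" by simp
  then show "monochromatic_colorings \<noteq> {}"
    using mono q by auto
qed

end

section \<open>Degrees\<close>

lemma degree_le_card:
  assumes "simple_graph G" "finite N" "\<And>w. {v, w} \<in> edges G \<Longrightarrow> w \<in> N"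
  shows "degree G v \<le> card N"
proof -
  have "{e \<in> edges G. v \<in> e} \<subseteq> (\<lambda>w. {v, w}) ` N"
  proof safe
    fix e assume e: "e \<in> edges G" "v \<in> e"
    then have "card e = 2" using assms(1) by (auto simp: simple_graph_def)
    then obtain w where "e = {v, w}" using e(2) by (auto simp: card_2_iff)
    then show "e \<in> (\<lambda>w. {v, w}) ` N" using assms(3) e(1) by blast
  qed
  then have "degree G v \<le> card ((\<lambda>w. {v, w}) ` N)"
    unfolding degree_def by (intro card_mono finite_imageI assms(2))
  also have "\<dots> \<le> card N" by (rule card_image_le) fact
  finally show ?thesis .
qed

context chain_construction
begin

lemma P_subset: "i \<in> {2..m} \<Longrightarrow> j \<in> {1..t} \<Longrightarrow> P b i j \<subseteq> clique_set q b i"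
  using P_cover by blast

text \<open>Each case records which sets the endpoints belong to, so that a vertex of known kind
  rules out most cases by its constructor.\<close>

lemma edge_cases:
  assumes "e \<in> edges (graph J)" "J \<subseteq> {1..m}"
  obtains
      (clique) b i u v where "i \<in> {1..m}" "u \<in> clique_set q b i" "v \<in> clique_set q b i"
        "u \<noteq> v" "e = {u, v}"
    | (clique_indep) b i u v where "i \<in> {1..m}" "u \<in> clique_set q b i" "v \<in> indep_set t b i"
        "e = {u, v}"
    | (indep_clique) b i j v where "i \<in> {2..m}" "j \<in> {1..t}" "v \<in> P b i j" "v \<in> clique_set q b i"
        "e = {Indep b (i - 1) j, v}"
    | (link) b i where "i \<in> {1..m}" "a b i \<in> indep_set t b i" "e = {Link i, a b i}"
    | (matching) i where "i \<in> {1..m}" "x i \<in> clique_set q Unprimed i" "y i \<in> indep_set t Primed i"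
        "e = {x i, y i}"
proof -
  from assms consider "e \<in> chain_edges q m t P a" | i where "i \<in> {1..m}" "e = {x i, y i}"
    unfolding graph_def by auto
  then show thesis
  proof cases
    case 1
    then show thesis
      unfolding chain_edges_iff using clique clique_indep indep_clique link a P_subset by blast
  next
    case 2
    then show thesis using matching x y by blast
  qed
qed

lemma simple_graph_graph:
  assumes J: "J \<subseteq> {1..m}"
  shows "simple_graph (graph J)"
  unfolding simple_graph_def
proof
  have sub: "v \<in> chain_verts q m t" if "v \<in> clique_set q b i \<or> v \<in> indep_set t b i" "i \<in> {1..m}" for v b i
    using that clique_set_subset[of i m q b t] indep_set_subset[of i m t b q] by blast
  have ne: "u \<noteq> v" if "u \<in> clique_set q b i" "v \<in> indep_set t b' i'" for u v b i b' i'
    using that by (auto simp: clique_set_def indep_set_def)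
  fix e assume "e \<in> edges (graph J)"
  from this J show "e \<subseteq> verts (graph J) \<and> card e = 2"
  proof (cases rule: edge_cases)
    case (indep_clique b i j v)
    then have "i - 1 \<in> {1..m}" "i \<in> {1..m}" "Indep b (i - 1) j \<in> indep_set t b (i - 1)"
      by (auto simp: indep_set_def)
    with indep_clique show ?thesis
      using ne[of v b i "Indep b (i - 1) j" b "i - 1"] sub[of _ b i] sub[of _ b "i - 1"]
      by (auto simp: graph_def)
  next
    case (link b i)
    then have "a b i \<noteq> Link i" by (auto simp: indep_set_def)
    with link show ?thesis using sub by (auto simp: graph_def Link_in_chain_verts)
  qed (use sub ne in \<open>auto simp: graph_def card_2_iff\<close>)
qed

text \<open>Neighbors: \<open>q - 2\<close> in the clique, \<open>t\<close> in its independent set,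
  at most one in the preceding independent set because the parts are disjoint, and at most one
  through the matching.\<close>

lemma degree_Clique_le:
  assumes J: "J \<subseteq> {1..m}" and v: "Clique b i k \<in> chain_verts q m t"
  shows "degree (graph J) (Clique b i k) \<le> q + t"
proof -
  define v where "v = Clique b i k"
  have i: "i \<in> {1..m}" and vi: "v \<in> clique_set q b i"
    using assms(2) by (auto simp: chain_verts_def clique_set_def indep_set_def v_def)
  define pre where "pre = {j \<in> {1..t}. v \<in> P b i j \<and> 2 \<le> i}"
  \<comment> \<open>\<open>y i\<close> is included for every clique vertex, also on the primed side;
    this can only overcount.\<close>
  define N where "N = (clique_set q b i - {v}) \<union> indep_set t b i \<union> Indep b (i - 1) ` pre \<union> {y i}"
  have pre: "card pre \<le> 1"
  proof -
    have "disjoint_family_on (P b i) {1..t}" if "2 \<le> i"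
      using partitions that i by (auto simp: balanced_partitions_def)
    then have "\<forall>j\<in>pre. \<forall>j'\<in>pre. j = j'"
      unfolding pre_def disjoint_family_on_def by blast
    then show ?thesis by (simp add: card_le_Suc0_iff_eq pre_def)
  qed
  have "degree (graph J) v \<le> card N"
  proof (rule degree_le_card[OF simple_graph_graph[OF J]])
    show "finite N" by (simp add: N_def clique_set_def indep_set_def pre_def)
    fix w assume "{v, w} \<in> edges (graph J)"
    from this J show "w \<in> N"
    proof (cases rule: edge_cases)
      case (clique b' i' u' v')
      then show ?thesis using vi by (auto simp: doubleton_eq_iff N_def clique_set_def v_def)
    next
      case (clique_indep b' i' u' v')
      then show ?thesis using vi by (auto simp: doubleton_eq_iff N_def clique_set_def indep_set_def v_def)
    next
      case (indep_clique b' i' j v')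
      then show ?thesis using vi by (auto simp: doubleton_eq_iff N_def clique_set_def pre_def v_def)
    next
      case (link b' i')
      then show ?thesis by (auto simp: doubleton_eq_iff indep_set_def v_def)
    next
      case (matching i')
      then show ?thesis by (auto simp: doubleton_eq_iff N_def clique_set_def indep_set_def v_def)
    qed
  qed
  also have "card N \<le> card (clique_set q b i - {v}) + card (indep_set t b i) + card (Indep b (i - 1) ` pre) + card {y i}"
    unfolding N_def by (intro order_trans[OF card_Un_le] add_mono order_refl)
  also have "\<dots> \<le> (q - 2) + t + 1 + 1"
  proof -
    have "card (clique_set q b i - {v}) = q - 2"
      using vi by (simp add: clique_set_def card_image inj_on_def)
    moreover have "card (indep_set t b i) = t"
      by (simp add: indep_set_def card_image inj_on_def)
    moreover have "card (Indep b (i - 1) ` pre) \<le> 1"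
      using pre card_image_le[of pre "Indep b (i - 1)"] by (simp add: pre_def)
    ultimately show ?thesis by simp
  qed
  finally show ?thesis using q by (simp add: v_def)
qed

text \<open>Neighbors: \<open>q - 1\<close> in the clique, one part of the next clique (none if
  \<open>i = m\<close>), and at most two more, namely the link and \<open>x i\<close>.\<close>

lemma degree_Indep_le:
  assumes J: "J \<subseteq> {1..m}" and v: "Indep b i k \<in> chain_verts q m t"
  shows "degree (graph J) (Indep b i k) \<le> q + nat \<lceil>real (q - 1) / real t\<rceil> + 1"
proof -
  have i: "i \<in> {1..m}" and k: "k \<in> {1..t}"
    using assms(2) by (auto simp: chain_verts_def clique_set_def indep_set_def)
  define post where "post = (if Suc i \<le> m then P b (Suc i) k else {})"
  define N where "N = clique_set q b i \<union> post \<union> {Link i, x i}"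
  have post: "finite post" "card post \<le> nat \<lceil>real (q - 1) / real t\<rceil>"
  proof -
    have "Suc i \<in> {2..m}" if "Suc i \<le> m" using that i by simp
    then have *: "finite (P b (Suc i) k)" "int (card (P b (Suc i) k)) \<in>
        {\<lfloor>real (q - 1) / real t\<rfloor>, \<lceil>real (q - 1) / real t\<rceil>}" if "Suc i \<le> m"
      using that k partitions finite_subset[OF P_subset[of "Suc i" k b]]
      by (auto simp: balanced_partitions_def clique_set_def)
    then show "finite post" by (simp add: post_def)
    have "int (card (P b (Suc i) k)) \<le> \<lceil>real (q - 1) / real t\<rceil>" if "Suc i \<le> m"
      using *(2)[OF that] floor_le_ceiling[of "real (q - 1) / real t"] by (elim insertE) simp_all
    then have "card (P b (Suc i) k) \<le> nat \<lceil>real (q - 1) / real t\<rceil>" if "Suc i \<le> m"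
      using that by linarith
    then show "card post \<le> nat \<lceil>real (q - 1) / real t\<rceil>" by (simp add: post_def)
  qed
  have "degree (graph J) (Indep b i k) \<le> card N"
  proof (rule degree_le_card[OF simple_graph_graph[OF J]])
    show "finite N" using post by (simp add: N_def clique_set_def)
    fix w assume "{Indep b i k, w} \<in> edges (graph J)"
    from this J show "w \<in> N"
    proof (cases rule: edge_cases)
      case (clique b' i' u' v')
      then show ?thesis by (auto simp: doubleton_eq_iff clique_set_def)
    next
      case (clique_indep b' i' u' v')
      then show ?thesis by (auto simp: doubleton_eq_iff N_def clique_set_def indep_set_def)
    next
      case (indep_clique b' i' j v')
      then have "b' = b" "i' = Suc i" "j = k" "w = v'"
        by (auto simp: doubleton_eq_iff clique_set_def)
      then show ?thesis using indep_clique by (auto simp: N_def post_def)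
    next
      case (link b' i')
      then show ?thesis by (auto simp: doubleton_eq_iff N_def indep_set_def)
    next
      case (matching i')
      then show ?thesis by (auto simp: doubleton_eq_iff N_def clique_set_def indep_set_def)
    qed
  qed
  also have "card N \<le> card (clique_set q b i) + card post + card {Link i, x i}"
    unfolding N_def by (intro order_trans[OF card_Un_le] add_mono order_refl)
  also have "\<dots> \<le> (q - 1) + nat \<lceil>real (q - 1) / real t\<rceil> + 2"
  proof -
    have "card (clique_set q b i) = q - 1"
      by (simp add: clique_set_def card_image inj_on_def)
    moreover have "card {Link i, x i} \<le> 2"
      by (simp add: card_insert_if)
    ultimately show ?thesis using post by simp
  qed
  finally show ?thesis using q by simp
qed

lemma degree_Link_le:
  assumes J: "J \<subseteq> {1..m}"
  shows "degree (graph J) (Link i) \<le> 2"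
proof -
  have "degree (graph J) (Link i) \<le> card {a Unprimed i, a Primed i}"
  proof (rule degree_le_card[OF simple_graph_graph[OF J]])
    fix w assume "{Link i, w} \<in> edges (graph J)"
    from this J show "w \<in> {a Unprimed i, a Primed i}"
    proof (cases rule: edge_cases)
      case (link b i')
      then show ?thesis by (cases b) (auto simp: doubleton_eq_iff indep_set_def)
    qed (auto simp: doubleton_eq_iff clique_set_def indep_set_def)
  qed simp
  also have "\<dots> \<le> 2" by (simp add: card_insert_if)
  finally show ?thesis .
qed

text \<open>The lower bound on \<open>d\<close> is the larger of the two degree bounds. It puts all
  \<open>2 ^ m\<close> graphs into the family, so the success guarantee covers each of them.\<close>

lemma graph_in_chain_family:
  assumes J: "J \<subseteq> {1..m}" and n: "n = (2 * q + 2 * t - 1) * m"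
    and d: "d \<ge> max (q + t) (q + nat \<lceil>real (q - 1) / real t\<rceil> + 1)"
  shows "graph J \<in> chain_family q m t n d P a x y"
proof -
  have "degree (graph J) v \<le> d" if "v \<in> chain_verts q m t" for v
  proof (cases v)
    case (Clique b i k)
    then show ?thesis using degree_Clique_le[OF J, of b i k] that d by simp
  next
    case (Indep b i k)
    then show ?thesis using degree_Indep_le[OF J, of b i k] that d by simp
  next
    case (Link i)
    then show ?thesis using degree_Link_le[OF J, of i] d q by simp
  qed
  then have "graph J \<in> bounded_degree_graphs (chain_verts q m t) n d"
    using simple_graph_graph[OF J] card_chain_verts[of q m t] q n
    by (simp add: bounded_degree_graphs_def graph_def)
  moreover have "graph J \<in> augmented_chain_graphs q m t P a x y"
    using J unfolding augmented_chain_graphs_def graph_def by blast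
  ultimately show ?thesis
    by (auto simp: chain_family_def)
qed

end

section \<open>The sample complexity bound\<close>

theorem theorem7:
  fixes q m t n d L :: nat
    and P :: "side \<Rightarrow> nat \<Rightarrow> nat \<Rightarrow> vertex set"
    and a :: "side \<Rightarrow> nat \<Rightarrow> vertex"
    and x y :: "nat \<Rightarrow> vertex"
    and A :: "vertex learner"
  assumes "q \<ge> 3" and "m \<ge> 1"
    and "t = nat \<lceil>sqrt (real (q - 1))\<rceil>"
    and "n = (2 * q + 2 * t - 1) * m"
    and "d \<ge> max (q + t) (q + nat \<lceil>real (q - 1) / real t\<rceil> + 1)"
    and "balanced_partitions q m t P"
    and "\<And>b i. i \<in> {1..m} \<Longrightarrow> a b i \<in> indep_set t b i"
    and "\<And>i. i \<in> {1..m} \<Longrightarrow> x i \<in> clique_set q Unprimed i"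
    and "\<And>i. i \<in> {1..m} \<Longrightarrow> y i \<in> indep_set t Primed i"
    and "\<And>i. i \<in> {1..m} \<Longrightarrow> {Link i, y i} \<notin> chain_edges q m t P a"
    and "learning_algorithm q (chain_family q m t n d P a x y) L A"
    and "succeeds_with_prob q (chain_family q m t n d P a x y) L A
           (real q * exp (- real m / (2 * real (q - 1))))"
  shows "real L \<ge> exp (real m / (2 * real (q - 1)))"
proof (rule ccontr)
  let ?F = "chain_family q m t n d P a x y"
  have "sqrt (real (q - 1)) > 0" using assms(1) by simp
  then have "t \<ge> 1" unfolding assms(3) by linarith
  then interpret chain_construction q m t P a x y
    using assms by unfold_locales auto
  define z where "z = 1 / real (q - 1)"
  \<comment> \<open>\<open>E\<close> links all quantities: the assumed success probability is
    \<open>real q * E\<close>, the claimed number of samples is the inverse of \<open>E\<close>, and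
    \<open>\<delta>\<close> is at most \<open>real (q - 1) * E\<^sup>2\<close>.\<close>
  define E where "E = exp (- real m / (2 * real (q - 1)))"
  define \<delta> where "\<delta> = real (q - 1) * (real (q - 2) / real (q - 1)) ^ m"
  have z: "0 < z" "z \<le> 1 / 2" "real (q - 2) / real (q - 1) = 1 - z"
    using assms(1) by (auto simp: z_def field_simps)
  have E: "E = exp (- z / 2) ^ m" "E > 0"
    by (simp_all add: E_def z_def flip: exp_of_nat_mult)
  have "\<delta> \<le> real (q - 1) * E\<^sup>2"
  proof -
    have "1 - z \<le> exp (- z)" using exp_ge_add_one_self[of "- z"] by simp
    then have "(1 - z) ^ m \<le> exp (- z) ^ m" using z by (intro power_mono) auto
    also have "\<dots> = E\<^sup>2"
      by (simp add: E(1) flip: exp_of_nat_mult)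
    finally show ?thesis unfolding \<delta>_def z(3) by (intro mult_left_mono) auto
  qed
  assume "\<not> real L \<ge> exp (real m / (2 * real (q - 1)))"
  then have "real L * E < exp (real m / (2 * real (q - 1))) * E"
    using E(2) by (intro mult_strict_right_mono) auto
  also have "\<dots> = 1" by (simp add: E_def flip: exp_add)
  finally have LE: "real L * E < 1" .
  \<comment> \<open>With too few samples, one factor \<open>E\<close> is absorbed by
    \<open>real L\<close>, leaving strictly less than \<open>real (q - 1) * E\<close>.\<close>
  have "real L * \<delta> \<le> real L * (real (q - 1) * E\<^sup>2)"
    using \<open>\<delta> \<le> _\<close> by (intro mult_left_mono) auto
  also have "\<dots> = (real L * E) * (real (q - 1) * E)"
    by (simp add: power2_eq_square)
  also have "\<dots> < 1 * (real (q - 1) * E)"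
    using LE E(2) assms(1) by (intro mult_strict_right_mono) auto
  finally have L\<delta>: "real L * \<delta> < real (q - 1) * E" by simp
  \<comment> \<open>The pure guessing probability \<open>1 / 2 ^ m\<close> is at most
    \<open>E\<close>, since \<open>2 * exp (- z / 2) \<ge> 2 - z \<ge> 1\<close>.\<close>
  have two: "2 ^ m * E \<ge> 1"
  proof -
    have "1 - z / 2 \<le> exp (- z / 2)" using exp_ge_add_one_self[of "- z / 2"] by simp
    then have "1 \<le> 2 * exp (- z / 2)" using z by simp
    then have "1 \<le> (2 * exp (- z / 2)) ^ m" by (rule one_le_power)
    then show ?thesis by (simp add: E(1) power_mult_distrib)
  qed
  \<comment> \<open>Summed over all \<open>J\<close>, the guarantee gives
    \<open>2 ^ m * (real q * E)\<close>, while the upper bound stays below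
    \<open>2 ^ m * (real (q - 1) * E) + 1\<close>. The difference is \<open>2 ^ m * E < 1\<close>,
    contradicting \<open>two\<close>.\<close>
  have "2 ^ m * (real q * E) = (\<Sum>J\<in>Pow {1..m}. real q * E)"
    by (simp add: card_Pow)
  also have "\<dots> \<le> (\<Sum>J\<in>Pow {1..m}. measure_pmf.prob (learner_output q L A (graph J))
             {H. proper_colorings q H = proper_colorings q (graph J)})"
    using assms(12) graph_in_chain_family[OF _ assms(4,5)]
    by (intro sum_mono) (auto simp: succeeds_with_prob_def E_def)
  also have "\<dots> \<le> real (card (Pow {1..m})) * (real L * \<delta>) + 1"
  proof (rule sum_success_prob_le[where Z = monochromatic_colorings])
    show "finite monochromatic_colorings"
      using monochromatic_colorings_subset[of "{}"] finite_proper_colorings finite_subset by blast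
    show "monochromatic_colorings \<noteq> {}"
      using card_mixed_colorings_le(2)[of "{}"] by simp
  qed (use inj_on_proper_colorings finite_proper_colorings monochromatic_colorings_subset
        card_mixed_colorings_le(1) in \<open>auto simp: \<delta>_def\<close>)
  also have "\<dots> < 2 ^ m * (real (q - 1) * E) + 1"
    using L\<delta> by (simp add: card_Pow)
  finally have "2 ^ m * E < 1"
    using assms(1) by (simp add: of_nat_diff algebra_simps)
  with two show False by simp
qed

end
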